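(* Let $\mathbb T$ be a time scale. If $f:\mathbb T\to\mathbb R$ is delta and nabla differentiable, then $f$ is symmetric differentiable and, for each $t\in\mathbb T_\kappa^\kappa$, $$f^\diamondsuit(t)=\gamma_1(t)f^\Delta(t)+\left(1-\gamma_1(t)\right)f^\nabla(t),$$ where $$\gamma_1(t)=\lim_{s\to t}\frac{\sigma(t)-s}{\sigma(t)+2t-2s-\rho(t)}.$$
   Context: A time scale $\mathbb T$ is a nonempty closed subset of $\mathbb R$ (with the relative topology; neighborhoods are in $\mathbb T$). $\sigma(t)=\inf\{s\in\mathbb T:s>t\}$ and $\rho(t)=\sup\{s\in\mathbb T:s<t\}$, with $\inf\emptyset=\sup\mathbb T$ and $\sup\emptyset=\inf\mathbb T$. $\mathbb T^\kappa$ is $\mathbb T$ minus its maximum if the maximum exists and is left-scattered ($\rho(\max)<\max$), otherwise $\mathbb T$; $\mathbb T_\kappa$ is $\mathbb T$ minus its minimum if the minimum exists and is right-scattered ($\sigma(\min)>\min$), otherwise $\mathbb T$; $\mathbb T_\kappa^\kappa=\mathbb T_\kappa\cap\mathbb T^\kappa$. $f^\sigma=f\circ\sigma$, $f^\rho=f\circ\rho$. Delta derivative: $f^\Delta(t)$, $t\in\mathbb T^\kappa$, is the number such that for every $\varepsilon>0$ there is a neighborhood $U$ of $t$ with $|f(\sigma(t))-f(s)-f^\Delta(t)(\sigma(t)-s)|\le\varepsilon|\sigma(t)-s|$ for all $s\in U$; $f$ is delta differentiable if $f^\Delta(t)$ exists for all $t\in\mathbb T^\kappa$. Nabla derivative: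 the same with $\rho$ in place of $\sigma$ and $\mathbb T_\kappa$ in place of $\mathbb T^\kappa$. Symmetric derivative: $f^\diamondsuit(t)$, $t\in\mathbb T_\kappa^\kappa$, is the real number (if it exists) such that for every $\varepsilon>0$ there is a neighborhood $U$ of $t$ such that, for all $s\in U$ for which $2t-s\in U$, $$\left|[f^\sigma(t)-f(s)+f(2t-s)-f^\rho(t)]-f^\diamondsuit(t)[\sigma(t)+2t-2s-\rho(t)]\right|\le\varepsilon\left|\sigma(t)+2t-2s-\rho(t)\right|;$$ $f$ is symmetric differentiable if $f^\diamondsuit(t)$ exists for all $t\in\mathbb T_\kappa^\kappa$. The limit defining $\gamma_1(t)$ is taken over the real variable $s\to t$, $s\ne t$. *)

theory Defs
  imports "HOL-Analysis.Analysis"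
begin

text \<open>
  A function on a time scale \<open>T\<close> is represented by a total function on the reals; every notion
  below evaluates it only at points of \<open>T\<close>.
\<close>

definition time_scale :: "real set \<Rightarrow> bool" where
  "time_scale T \<longleftrightarrow> closed T \<and> T \<noteq> {}"

text \<open>
  The case distinctions implement the conventions \<open>inf \<emptyset> = sup T\<close> and \<open>sup \<emptyset> = inf T\<close>.
\<close>

definition fwd_jump :: "real set \<Rightarrow> real \<Rightarrow> real" where
  "fwd_jump T t = (if {s \<in> T. s > t} = {} then Sup T else Inf {s \<in> T. s > t})"

definition bwd_jump :: "real set \<Rightarrow> real \<Rightarrow> real" where
  "bwd_jump T t = (if {s \<in> T. s < t} = {} then Inf T else Sup {s \<in> T. s < t})"

definition kappa_upper :: "real set \<Rightarrow> real set" where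
  "kappa_upper T = T - {m \<in> T. (\<forall>s\<in>T. s \<le> m) \<and> bwd_jump T m < m}"

definition kappa_lower :: "real set \<Rightarrow> real set" where
  "kappa_lower T = T - {m \<in> T. (\<forall>s\<in>T. m \<le> s) \<and> fwd_jump T m > m}"

definition kappa_both :: "real set \<Rightarrow> real set" where
  "kappa_both T = kappa_lower T \<inter> kappa_upper T"

definition has_delta_derivative :: "real set \<Rightarrow> (real \<Rightarrow> real) \<Rightarrow> real \<Rightarrow> real \<Rightarrow> bool" where
  "has_delta_derivative T f t D \<longleftrightarrow>
    (\<forall>\<epsilon>>0. \<exists>U. openin (top_of_set T) U \<and> t \<in> U \<and>
      (\<forall>s\<in>U. \<bar>f (fwd_jump T t) - f s - D * (fwd_jump T t - s)\<bar> \<le> \<epsilon> * \<bar>fwd_jump T t - s\<bar>))"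

definition has_nabla_derivative :: "real set \<Rightarrow> (real \<Rightarrow> real) \<Rightarrow> real \<Rightarrow> real \<Rightarrow> bool" where
  "has_nabla_derivative T f t D \<longleftrightarrow>
    (\<forall>\<epsilon>>0. \<exists>U. openin (top_of_set T) U \<and> t \<in> U \<and>
      (\<forall>s\<in>U. \<bar>f (bwd_jump T t) - f s - D * (bwd_jump T t - s)\<bar> \<le> \<epsilon> * \<bar>bwd_jump T t - s\<bar>))"

definition has_symmetric_derivative :: "real set \<Rightarrow> (real \<Rightarrow> real) \<Rightarrow> real \<Rightarrow> real \<Rightarrow> bool" where
  "has_symmetric_derivative T f t D \<longleftrightarrow>
    (\<forall>\<epsilon>>0. \<exists>U. openin (top_of_set T) U \<and> t \<in> U \<and>
      (\<forall>s\<in>U. 2 * t - s \<in> U \<longrightarrow>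
        \<bar>(f (fwd_jump T t) - f s + f (2 * t - s) - f (bwd_jump T t))
          - D * (fwd_jump T t + 2 * t - 2 * s - bwd_jump T t)\<bar>
        \<le> \<epsilon> * \<bar>fwd_jump T t + 2 * t - 2 * s - bwd_jump T t\<bar>))"

definition delta_differentiable :: "real set \<Rightarrow> (real \<Rightarrow> real) \<Rightarrow> bool" where
  "delta_differentiable T f \<longleftrightarrow> (\<forall>t\<in>kappa_upper T. \<exists>D. has_delta_derivative T f t D)"

definition nabla_differentiable :: "real set \<Rightarrow> (real \<Rightarrow> real) \<Rightarrow> bool" where
  "nabla_differentiable T f \<longleftrightarrow> (\<forall>t\<in>kappa_lower T. \<exists>D. has_nabla_derivative T f t D)"

definition symmetric_differentiable :: "real set \<Rightarrow> (real \<Rightarrow> real) \<Rightarrow> bool" where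
  "symmetric_differentiable T f \<longleftrightarrow> (\<forall>t\<in>kappa_both T. \<exists>D. has_symmetric_derivative T f t D)"

definition gamma1_quotient :: "real set \<Rightarrow> real \<Rightarrow> real \<Rightarrow> real" where
  "gamma1_quotient T t s =
    (fwd_jump T t - s) / (fwd_jump T t + 2 * t - 2 * s - bwd_jump T t)"

definition gamma1 :: "real set \<Rightarrow> real \<Rightarrow> real" where
  "gamma1 T t = Lim (at t) (gamma1_quotient T t)"

text \<open>
  The derivatives are predicates because the defining conditions do not always single out a
  number: if \<open>T\<close> is a singleton, every real is a delta, nabla and symmetric derivative; if \<open>t\<close> is
  dense with no symmetric pair \<open>s\<close>, \<open>2 * t - s\<close> of other points of \<open>T\<close> near it (for instance
  \<open>t = max T\<close> left-dense), every real is a symmetric derivative at \<open>t\<close>.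
  Apart from these points the symmetric derivative is unique:
\<close>

lemma has_symmetric_derivative_unique:
  assumes "t \<in> T"
    and nondeg: "fwd_jump T t \<noteq> bwd_jump T t \<or> t islimpt {s \<in> T. 2 * t - s \<in> T}"
    and D: "has_symmetric_derivative T f t D" and E: "has_symmetric_derivative T f t E"
  shows "D = E"
proof (rule ccontr)
  assume "D \<noteq> E"
  define \<epsilon> where "\<epsilon> = \<bar>D - E\<bar> / 4"
  have eps: "\<epsilon> > 0" using \<open>D \<noteq> E\<close> by (simp add: \<epsilon>_def)
  define h where "h s = fwd_jump T t + 2 * t - 2 * s - bwd_jump T t" for s
  define g where "g s = f (fwd_jump T t) - f s + f (2 * t - s) - f (bwd_jump T t)" for s
  have sym: "has_symmetric_derivative T f t c \<longleftrightarrow>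
      (\<forall>e>0. \<exists>U. openin (top_of_set T) U \<and> t \<in> U \<and>
        (\<forall>s\<in>U. 2 * t - s \<in> U \<longrightarrow> \<bar>g s - c * h s\<bar> \<le> e * \<bar>h s\<bar>))" for c
    unfolding has_symmetric_derivative_def g_def h_def by (rule refl)
  from D[unfolded sym, rule_format, OF eps]
  obtain U where U: "openin (top_of_set T) U" "t \<in> U"
    "\<forall>s\<in>U. 2 * t - s \<in> U \<longrightarrow> \<bar>g s - D * h s\<bar> \<le> \<epsilon> * \<bar>h s\<bar>"
    by (elim exE conjE)
  from E[unfolded sym, rule_format, OF eps]
  obtain V where V: "openin (top_of_set T) V" "t \<in> V"
    "\<forall>s\<in>V. 2 * t - s \<in> V \<longrightarrow> \<bar>g s - E * h s\<bar> \<le> \<epsilon> * \<bar>h s\<bar>"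
    by (elim exE conjE)
  have "openin (top_of_set T) (U \<inter> V)" "t \<in> U \<inter> V"
    using U(1,2) V(1,2) by (auto intro: openin_Int)
  then obtain r where r: "r > 0" "ball t r \<inter> T \<subseteq> U \<inter> V"
    by (meson openin_contains_ball)
  obtain s where s: "s \<in> U \<inter> V" "2 * t - s \<in> U \<inter> V" "h s \<noteq> 0"
  proof (cases "fwd_jump T t = bwd_jump T t")
    case False
    then show ?thesis using that[of t] U(2) V(2) by (simp add: h_def)
  next
    case True
    then have "t islimpt {s \<in> T. 2 * t - s \<in> T}" using nondeg by simp
    then obtain s where "s \<in> T" "2 * t - s \<in> T" "s \<noteq> t" "dist s t < r"
      using r(1) by (auto simp: islimpt_approachable)
    then have "s \<in> U \<inter> V" "2 * t - s \<in> U \<inter> V" "h s \<noteq> 0"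
      using r(2) True by (auto simp: dist_real_def h_def subset_iff)
    then show ?thesis by (rule that)
  qed
  have "\<bar>(D - E) * h s\<bar> \<le> \<bar>g s - D * h s\<bar> + \<bar>g s - E * h s\<bar>"
    by (simp add: algebra_simps)
  also have "\<dots> \<le> \<epsilon> * \<bar>h s\<bar> + \<epsilon> * \<bar>h s\<bar>"
    using U(3) V(3) s(1,2) by (intro add_mono) auto
  finally have "\<bar>D - E\<bar> * \<bar>h s\<bar> \<le> (\<bar>D - E\<bar> / 2) * \<bar>h s\<bar>"
    unfolding \<epsilon>_def abs_mult by linarith
  moreover have "\<bar>D - E\<bar> * \<bar>h s\<bar> > 0"
    using s(3) \<open>D \<noteq> E\<close> by simp
  ultimately show False by linarith
qed

end

theory Submission imports Defs begin

text \<open>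
  With \<open>a = \<sigma>(t) - s\<close> and \<open>b = 2t - s - \<rho>(t)\<close>, the symmetric difference of \<open>f\<close> is the delta
  difference at \<open>s\<close> minus the nabla difference at \<open>2t - s\<close>, hence \<open>f\<^sup>\<Delta> a + f\<^sup>\<nabla> b\<close> up to
  \<open>o(\<bar>a\<bar> + \<bar>b\<bar>)\<close>. Near \<open>t\<close> both \<open>\<bar>a\<bar>\<close> and \<open>\<bar>b\<bar>\<close> are \<open>O(\<bar>a + b\<bar>)\<close>, and
  \<open>a = \<gamma>\<^sub>1 (a + b) + o(\<bar>a + b\<bar>)\<close>, so the symmetric difference is
  \<open>(\<gamma>\<^sub>1 f\<^sup>\<Delta> + (1 - \<gamma>\<^sub>1) f\<^sup>\<nabla>) (a + b)\<close> up to \<open>o(\<bar>a + b\<bar>)\<close>.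
\<close>

lemma fwd_jump_ge:
  assumes "t \<in> T"
  shows "t \<le> fwd_jump T t"
proof (cases "{s \<in> T. s > t} = {}")
  case True
  then have "Sup T = t"
    using assms by (intro cSup_eq_maximum) (auto simp: not_less)
  with True show ?thesis by (simp add: fwd_jump_def)
next
  case False
  then have "t \<le> Inf {s \<in> T. s > t}" by (intro cInf_greatest) auto
  with False show ?thesis unfolding fwd_jump_def by (subst if_not_P) auto
qed

lemma bwd_jump_le:
  assumes "t \<in> T"
  shows "bwd_jump T t \<le> t"
proof (cases "{s \<in> T. s < t} = {}")
  case True
  then have "Inf T = t"
    using assms by (intro cInf_eq_minimum) (auto simp: not_less)
  with True show ?thesis by (simp add: bwd_jump_def)
next
  case False
  then have "Sup {s \<in> T. s < t} \<le> t" by (intro cSup_least) auto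
  with False show ?thesis unfolding bwd_jump_def by (subst if_not_P) auto
qed

lemma gamma1_quotient_tendsto_dense:
  assumes "fwd_jump T t = t" "bwd_jump T t = t"
  shows "(gamma1_quotient T t \<longlongrightarrow> 1 / 2) (at t)"
proof (rule tendsto_eventually)
  \<comment> \<open>The quotient is \<open>(t - s) / (2 * (t - s))\<close>; at \<open>s = t\<close>
    it would be \<open>0 / 0 = 0\<close>, so the punctured filter matters.\<close>
  have "gamma1_quotient T t s = 1 / 2" if "s \<noteq> t" for s
    using that assms by (simp add: gamma1_quotient_def divide_simps)
  then show "\<forall>\<^sub>F s in at t. gamma1_quotient T t s = 1 / 2"
    by (auto simp: eventually_at_filter)
qed

lemma gamma1_quotient_tendsto_scattered:
  assumes "bwd_jump T t < fwd_jump T t"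
  shows "(gamma1_quotient T t \<longlongrightarrow> (fwd_jump T t - t) / (fwd_jump T t - bwd_jump T t)) (at t)"
proof -
  have "((\<lambda>s. (fwd_jump T t - s) / (fwd_jump T t + 2 * t - 2 * s - bwd_jump T t)) \<longlongrightarrow>
      (fwd_jump T t - t) / (fwd_jump T t + 2 * t - 2 * t - bwd_jump T t)) (at t)"
    using assms by (intro tendsto_intros) auto
  then show ?thesis by (simp add: gamma1_quotient_def[abs_def])
qed

lemma gamma1_eqI:
  "(gamma1_quotient T t \<longlongrightarrow> c) (at t) \<Longrightarrow> gamma1 T t = c"
  unfolding gamma1_def by (intro tendsto_Lim) auto

text \<open>Since \<rho>(t) \<le> t \<le> \<sigma>(t), the two jumps either differ or both equal t.
  The case \<open>scattered\<close> thus includes points that are scattered on one side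
  only.\<close>

lemma gamma1_dense_or_scattered:
  assumes "t \<in> T"
  obtains (dense) "fwd_jump T t = t" "bwd_jump T t = t" "gamma1 T t = 1 / 2"
  | (scattered) "bwd_jump T t < fwd_jump T t"
      "gamma1 T t = (fwd_jump T t - t) / (fwd_jump T t - bwd_jump T t)"
proof (cases "bwd_jump T t < fwd_jump T t")
  case True
  then show ?thesis
    using scattered gamma1_eqI[OF gamma1_quotient_tendsto_scattered] by blast
next
  case False
  then have "fwd_jump T t = t" "bwd_jump T t = t"
    using fwd_jump_ge[OF assms] bwd_jump_le[OF assms] by linarith+
  then show ?thesis
    using dense gamma1_eqI[OF gamma1_quotient_tendsto_dense] by blast
qed

text \<open>\<open>Lim\<close> yields some value even for a divergent function; this certifies that
  \<open>gamma1\<close> is a genuine limit.\<close>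

lemma gamma1_quotient_tendsto_gamma1:
  assumes "t \<in> T"
  shows "(gamma1_quotient T t \<longlongrightarrow> gamma1 T t) (at t)"
  using assms
proof (cases rule: gamma1_dense_or_scattered)
  case dense
  then show ?thesis using gamma1_quotient_tendsto_dense[of T t] by metis
next
  case scattered
  then show ?thesis using gamma1_quotient_tendsto_scattered[of T t] by metis
qed

text \<open>At a dense point \<open>a = b\<close> makes the error term vanish. At a scattered point
  \<open>a + b\<close> stays away from 0 while the error tends to 0 with
  \<open>t - s\<close>.\<close>

lemma symmetric_increment_estimates:
  fixes t c e :: real
  assumes "t \<in> T" "e > 0"
  shows "\<exists>r>0. \<forall>s. \<bar>s - t\<bar> < r \<longrightarrow>
    (let a = fwd_jump T t - s; b = 2 * t - s - bwd_jump T t in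
      \<bar>a\<bar> \<le> 4 * \<bar>a + b\<bar> \<and> \<bar>b\<bar> \<le> 4 * \<bar>a + b\<bar> \<and>
      \<bar>c * (a - gamma1 T t * (a + b))\<bar> \<le> e * \<bar>a + b\<bar>)"
  using assms(1)
proof (cases rule: gamma1_dense_or_scattered)
  case dense
  have "\<bar>a\<bar> \<le> 4 * \<bar>a + a\<bar> \<and> \<bar>c * (a - 1 / 2 * (a + a))\<bar> \<le> e * \<bar>a + a\<bar>" for a
    using assms(2) by simp
  moreover have "2 * t - s - t = t - s" for s by simp
  ultimately show ?thesis
    \<comment> \<open>The bounds hold for every s, so the radius 1 is arbitrary.\<close>
    unfolding Let_def dense by (intro exI[of _ 1] conjI[OF zero_less_one] allI impI) (simp only:)
next
  case scattered
  define p where "p = fwd_jump T t - t"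
  define q where "q = t - bwd_jump T t"
  define g where "g = gamma1 T t"
  have pq: "p \<ge> 0" "q \<ge> 0" "p + q > 0"
    using fwd_jump_ge[OF assms(1)] bwd_jump_le[OF assms(1)] scattered(1)
    by (auto simp: p_def q_def)
  have g: "g = p / (p + q)" unfolding g_def scattered(2) by (simp add: p_def q_def)
  then have g01: "0 \<le> g" "g \<le> 1" using pq by auto
  \<comment> \<open>The first bound keeps \<open>a + b\<close> above half of \<open>p + q\<close>;
    the second makes \<open>\<bar>c\<bar> * \<bar>t - s\<bar>\<close> at most
    \<open>e * (p + q) / 2\<close>. The \<open>+ 1\<close> covers \<open>c = 0\<close>.\<close>
  define r where "r = min ((p + q) / 4) (e * (p + q) / (2 * (\<bar>c\<bar> + 1)))"
  have "r > 0" using pq assms(2) by (simp add: r_def)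
  have est: "\<bar>a\<bar> \<le> 4 * \<bar>a + b\<bar> \<and> \<bar>b\<bar> \<le> 4 * \<bar>a + b\<bar> \<and>
      \<bar>c * (a - g * (a + b))\<bar> \<le> e * \<bar>a + b\<bar>"
    if s: "\<bar>s - t\<bar> < r" and ab: "a = p + (t - s)" "b = q + (t - s)" for s a b
  proof -
    have s4: "\<bar>t - s\<bar> < (p + q) / 4" using s by (simp add: r_def abs_minus_commute)
    have half: "(p + q) / 2 \<le> a + b"
      using s4 ab unfolding abs_less_iff by (simp add: field_simps)
    \<comment> \<open>Each of \<open>\<bar>a\<bar>\<close>, \<open>\<bar>b\<bar>\<close> is at most
      \<open>5 / 4 * (p + q)\<close>, hence at most \<open>5 / 2 * (a + b)\<close>.\<close>
    have small: "\<bar>a\<bar> \<le> 4 * \<bar>a + b\<bar>" "\<bar>b\<bar> \<le> 4 * \<bar>a + b\<bar>"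
      using s4 half ab pq unfolding abs_less_iff abs_le_iff by (auto simp: field_simps)
    \<comment> \<open>The constant terms cancel because \<open>g * (p + q) = p\<close>.\<close>
    have "a - g * (a + b) = (1 - 2 * g) * (t - s)"
      using pq by (simp add: ab g field_simps)
    moreover have "\<bar>(1 - 2 * g) * (t - s)\<bar> \<le> 1 * \<bar>t - s\<bar>"
      unfolding abs_mult using g01 by (intro mult_right_mono) auto
    ultimately have "\<bar>c * (a - g * (a + b))\<bar> \<le> \<bar>c\<bar> * \<bar>t - s\<bar>"
      by (simp add: abs_mult mult_left_mono)
    also have "\<dots> \<le> (\<bar>c\<bar> + 1) * (e * (p + q) / (2 * (\<bar>c\<bar> + 1)))"
      using s by (intro mult_mono) (auto simp: r_def abs_minus_commute)
    also have "\<dots> = e * ((p + q) / 2)" by (simp add: field_simps)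
    also have "\<dots> \<le> e * \<bar>a + b\<bar>" using assms(2)
      by (intro mult_left_mono order_trans[OF half abs_ge_self]) auto
    finally show ?thesis using small by blast
  qed
  show ?thesis
  proof (intro exI[of _ r] conjI allI impI \<open>r > 0\<close>)
    fix s assume "\<bar>s - t\<bar> < r"
    from est[OF this, of "fwd_jump T t - s" "2 * t - s - bwd_jump T t"]
    show "let a = fwd_jump T t - s; b = 2 * t - s - bwd_jump T t in
      \<bar>a\<bar> \<le> 4 * \<bar>a + b\<bar> \<and> \<bar>b\<bar> \<le> 4 * \<bar>a + b\<bar> \<and>
      \<bar>c * (a - gamma1 T t * (a + b))\<bar> \<le> e * \<bar>a + b\<bar>"
      by (simp add: p_def q_def g_def Let_def)
  qed
qed

lemma has_symmetric_derivative_delta_nabla: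
  assumes "t \<in> T"
    and d: "has_delta_derivative T f t d" and n: "has_nabla_derivative T f t n"
  shows "has_symmetric_derivative T f t (gamma1 T t * d + (1 - gamma1 T t) * n)"
  unfolding has_symmetric_derivative_def
proof (intro allI impI)
  fix e :: real assume "e > 0"
  \<comment> \<open>Error budget: the factor 4 in the increment bounds turns each
    \<open>e / 16\<close> into \<open>e / 4\<close>; the replacement of \<open>a\<close> by its
    \<open>gamma1\<close> share costs the other \<open>e / 2\<close>.\<close>
  then have e: "e / 16 > 0" "e / 2 > 0" by auto
  from d[unfolded has_delta_derivative_def, rule_format, OF e(1)]
  obtain U where U: "openin (top_of_set T) U" "t \<in> U"
    "\<forall>s\<in>U. \<bar>f (fwd_jump T t) - f s - d * (fwd_jump T t - s)\<bar> \<le> e / 16 * \<bar>fwd_jump T t - s\<bar>"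
    by (elim exE conjE)
  from n[unfolded has_nabla_derivative_def, rule_format, OF e(1)]
  obtain V where V: "openin (top_of_set T) V" "t \<in> V"
    "\<forall>s\<in>V. \<bar>f (bwd_jump T t) - f s - n * (bwd_jump T t - s)\<bar> \<le> e / 16 * \<bar>bwd_jump T t - s\<bar>"
    by (elim exE conjE)
  from symmetric_increment_estimates[OF assms(1) e(2), of "d - n"]
  obtain r where r: "r > 0" and est: "\<forall>s. \<bar>s - t\<bar> < r \<longrightarrow>
    (let a = fwd_jump T t - s; b = 2 * t - s - bwd_jump T t in
      \<bar>a\<bar> \<le> 4 * \<bar>a + b\<bar> \<and> \<bar>b\<bar> \<le> 4 * \<bar>a + b\<bar> \<and>
      \<bar>(d - n) * (a - gamma1 T t * (a + b))\<bar> \<le> e / 2 * \<bar>a + b\<bar>)"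
    by (elim exE conjE)
  \<comment> \<open>The delta estimate will be used at \<open>s\<close> and the nabla estimate at
    \<open>2 * t - s\<close>; the definition asks for one neighborhood containing both
    points.\<close>
  define W where "W = U \<inter> V \<inter> (T \<inter> ball t r)"
  have "openin (top_of_set T) W"
    unfolding W_def by (intro openin_Int openin_open_Int U(1) V(1) open_ball)
  moreover have "t \<in> W"
    using U(2) V(2) r assms(1) by (simp add: W_def)
  moreover have "\<bar>(f (fwd_jump T t) - f s + f (2 * t - s) - f (bwd_jump T t))
      - (gamma1 T t * d + (1 - gamma1 T t) * n) * (fwd_jump T t + 2 * t - 2 * s - bwd_jump T t)\<bar>
      \<le> e * \<bar>fwd_jump T t + 2 * t - 2 * s - bwd_jump T t\<bar>"
    if s: "s \<in> W" "2 * t - s \<in> W" for s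
  proof -
    define a where "a = fwd_jump T t - s"
    define b where "b = 2 * t - s - bwd_jump T t"
    define x where "x = f (fwd_jump T t) - f s - d * a"
    \<comment> \<open>The nabla increment at \<open>2 * t - s\<close> is \<open>- b\<close>, whence
      the plus sign.\<close>
    define y where "y = f (bwd_jump T t) - f (2 * t - s) + n * b"
    define z where "z = (d - n) * (a - gamma1 T t * (a + b))"
    have ab: "fwd_jump T t + 2 * t - 2 * s - bwd_jump T t = a + b"
      by (simp add: a_def b_def)
    have "\<bar>s - t\<bar> < r" using s(1) by (simp add: W_def dist_real_def abs_minus_commute)
    from est[rule_format, OF this] have *: "\<bar>a\<bar> \<le> 4 * \<bar>a + b\<bar>" "\<bar>b\<bar> \<le> 4 * \<bar>a + b\<bar>" "\<bar>z\<bar> \<le> e / 2 * \<bar>a + b\<bar>"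
      by (auto simp: Let_def a_def b_def z_def)
    have "\<bar>x\<bar> \<le> e / 16 * \<bar>a\<bar>"
      using U(3)[rule_format, of s] s(1) by (simp add: W_def x_def a_def)
    also have "\<dots> \<le> e / 16 * (4 * \<bar>a + b\<bar>)" using * e by (intro mult_left_mono) auto
    finally have x: "\<bar>x\<bar> \<le> e / 4 * \<bar>a + b\<bar>" by simp
    have b': "bwd_jump T t - (2 * t - s) = - b" by (simp add: b_def)
    have "\<bar>y\<bar> \<le> e / 16 * \<bar>b\<bar>"
      using V(3)[rule_format, of "2 * t - s"] s(2) unfolding b' by (simp add: W_def y_def)
    also have "\<dots> \<le> e / 16 * (4 * \<bar>a + b\<bar>)" using * e by (intro mult_left_mono) auto
    finally have y: "\<bar>y\<bar> \<le> e / 4 * \<bar>a + b\<bar>" by simp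
    \<comment> \<open>Here \<open>z\<close> is exactly \<open>d * a + n * b\<close> minus the
      claimed derivative times \<open>a + b\<close>.\<close>
    have "(f (fwd_jump T t) - f s + f (2 * t - s) - f (bwd_jump T t))
      - (gamma1 T t * d + (1 - gamma1 T t) * n) * (a + b) = x - y + z"
      by (simp add: x_def y_def z_def algebra_simps)
    moreover have "\<bar>x - y + z\<bar> \<le> \<bar>x\<bar> + \<bar>y\<bar> + \<bar>z\<bar>" by linarith
    moreover have "\<bar>x\<bar> + \<bar>y\<bar> + \<bar>z\<bar> \<le> e * \<bar>a + b\<bar>" using x y *(3) by (simp add: field_simps)
    ultimately show ?thesis unfolding ab by linarith
  qed
  ultimately show "\<exists>U. openin (top_of_set T) U \<and> t \<in> U \<and>
      (\<forall>s\<in>U. 2 * t - s \<in> U \<longrightarrow>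
        \<bar>(f (fwd_jump T t) - f s + f (2 * t - s) - f (bwd_jump T t))
          - (gamma1 T t * d + (1 - gamma1 T t) * n) * (fwd_jump T t + 2 * t - 2 * s - bwd_jump T t)\<bar>
        \<le> e * \<bar>fwd_jump T t + 2 * t - 2 * s - bwd_jump T t\<bar>)"
    by (intro exI[of _ W] conjI ballI impI)
qed

theorem proposition8p2p10:
  fixes T :: "real set" and f :: "real \<Rightarrow> real"
  assumes "time_scale T"
    and "delta_differentiable T f"
    and "nabla_differentiable T f"
  shows "symmetric_differentiable T f \<and>
    (\<forall>t\<in>kappa_both T.
      (gamma1_quotient T t \<longlongrightarrow> gamma1 T t) (at t) \<and>
      (\<forall>d n. has_delta_derivative T f t d \<longrightarrow> has_nabla_derivative T f t n \<longrightarrow>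
        has_symmetric_derivative T f t (gamma1 T t * d + (1 - gamma1 T t) * n)))"
proof -
  have kappa: "t \<in> T" "t \<in> kappa_upper T" "t \<in> kappa_lower T" if "t \<in> kappa_both T" for t
    using that by (auto simp: kappa_both_def kappa_lower_def)
  have "symmetric_differentiable T f"
    unfolding symmetric_differentiable_def
  proof
    fix t assume "t \<in> kappa_both T"
    note t = kappa[OF this]
    obtain d n where "has_delta_derivative T f t d" "has_nabla_derivative T f t n"
      using assms(2,3) t(2,3) unfolding delta_differentiable_def nabla_differentiable_def by blast
    then show "\<exists>D. has_symmetric_derivative T f t D"
      using has_symmetric_derivative_delta_nabla[OF t(1)] by blast
  qed
  then show ?thesis
    using kappa(1) by (blast intro: gamma1_quotient_tendsto_gamma1 has_symmetric_derivative_delta_nabla)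
qed

end
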